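(* Given any continuous, non-increasing function $W : [0,1) \to (0,1)$ with $\lim_{r\to 1^-} W(r) = 0$, there exist functions $f, g \in \mathcal{B}_0$ such that $$|f'(z)| + |g'(z)| \geq \frac{W(|z|)}{1-|z|} \quad \text{for all } z \in \mathbb{D}.$$
   Context: $\mathbb{D}$ is the open unit disc of $\mathbb{C}$. The little Bloch space $\mathcal{B}_0$ consists of the functions $g$ analytic on $\mathbb{D}$ such that $\lim_{|z|\to 1}(1-|z|^2)|g'(z)| = 0$. *)

theory Defs
  imports "HOL-Complex_Analysis.Complex_Analysis"
begin

(* Functions on the disc are total functions on the complex plane; their values outside
   ball 0 1 are irrelevant.  The filter filtercomap norm (at_left 1) expresses that
   norm z tends to 1 from below, uniformly in the argument of z. *)

definition little_bloch :: "(complex \<Rightarrow> complex) set" where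
  "little_bloch = {g. g analytic_on ball 0 1 \<and>
     ((\<lambda>z. (1 - (norm z)\<^sup>2) * norm (deriv g z)) \<longlongrightarrow> 0) (filtercomap norm (at_left 1))}"

end

(* Both derivatives are lacunary series: f' = SUM j even and g' = SUM j odd of c_j 10^j z^(10^j - 1).
   On the annulus 10^-(J+1) <= 1 - |z| <= 10^-J the J-th term has modulus comparable to
   c_J / (1 - |z|), and it dominates the other terms of the series it belongs to as long as
   c decreases to 0 and c_j <= 2 c_(j+1).  Any null sequence, in particular W (1 - 10^-j), has
   a majorant c of this kind, and c_j --> 0 puts both series in the little Bloch class. *)
theory Submission
  imports Defs
begin

section \<open>Growth of the model series with terms 10^j r^(10^j - 1) as r tends to 1\<close>

text \<open>The difference r^n - r^m is 1 - r times the sum of the m - n powers r^i with n <= i < m,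
  each of which is at least r^(m - 1).\<close>

lemma one_minus_mult_power_le:
  fixes r :: real
  assumes "0 \<le> r" "r \<le> 1" "n \<le> m"
  shows "(1 - r) * (real m - real n) * r ^ (m - 1) \<le> r ^ n - r ^ m"
  using \<open>n \<le> m\<close>
proof (induction m rule: dec_induct)
  case (step m)
  have "(1 - r) * (real m - real n) * r ^ m \<le> (1 - r) * (real m - real n) * r ^ (m - 1)"
    using assms step by (intro mult_left_mono power_decreasing) auto
  with step.IH show ?case
    by (simp add: algebra_simps)
qed simp

text \<open>Telescoping: since 10^(j+1) = 10/9 (10^(j+1) - 10^j), the preceding lemma bounds 1 - r
  times the term of index j + 1 by 10/9 times the drop from r^(10^j) to r^(10^(j+1)).\<close>

lemma lacunary_partial_sum_le:
  fixes r :: real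
  assumes "0 \<le> r" "r \<le> 1"
  shows "(1 - r) * (\<Sum>j\<le>J. 10 ^ j * r ^ (10 ^ j - 1)) \<le> 10 / 9 * (1 - r ^ (10 ^ J))"
proof (induction J)
  case (Suc J)
  have "(1 - r) * (9 * 10 ^ J) * r ^ (10 ^ Suc J - 1) \<le> r ^ (10 ^ J) - r ^ (10 ^ Suc J)"
    using one_minus_mult_power_le[OF assms, of "10 ^ J" "10 ^ Suc J"] by simp
  then have "(1 - r) * (10 ^ Suc J * r ^ (10 ^ Suc J - 1)) \<le> 10 / 9 * (r ^ (10 ^ J) - r ^ (10 ^ Suc J))"
    by simp
  with Suc show ?case
    by (simp only: sum.atMost_Suc distrib_left right_diff_distrib)
qed (use assms in simp)

lemma
  fixes r :: real
  assumes "0 \<le> r" "r < 1"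
  shows summable_lacunary: "summable (\<lambda>j. 10 ^ j * r ^ (10 ^ j - 1))"
    and suminf_lacunary_le: "(\<Sum>j. 10 ^ j * r ^ (10 ^ j - 1)) \<le> 10 / 9 / (1 - r)"
proof -
  have *: "(\<Sum>j\<in>{..<n}. 10 ^ j * r ^ (10 ^ j - 1)) \<le> 10 / 9 / (1 - r)" for n
  proof -
    have "(\<Sum>j\<in>{..<n}. 10 ^ j * r ^ (10 ^ j - 1)) \<le> (\<Sum>j\<le>n. 10 ^ j * r ^ (10 ^ j - 1))"
      using assms by (intro sum_mono2) auto
    also have "\<dots> \<le> 10 / 9 / (1 - r)"
    proof -
      have "(1 - r) * (\<Sum>j\<le>n. 10 ^ j * r ^ (10 ^ j - 1)) \<le> 10 / 9 * (1 - r ^ (10 ^ n))"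
        using lacunary_partial_sum_le assms by simp
      also have "\<dots> \<le> 10 / 9"
        using assms by simp
      finally show ?thesis
        using assms pos_le_divide_eq[of "1 - r"] by (metis diff_gt_0_iff_gt mult.commute)
    qed
    finally show ?thesis .
  qed
  show s: "summable (\<lambda>j. 10 ^ j * r ^ (10 ^ j - 1))"
    using * assms by (intro summableI_nonneg_bounded) auto
  show "(\<Sum>j. 10 ^ j * r ^ (10 ^ j - 1)) \<le> 10 / 9 / (1 - r)"
    using * s by (intro suminf_le_const)
qed

section \<open>Lacunary series as derivatives of little Bloch functions\<close>

text \<open>This is the termwise derivative of the gap series with terms c_j z^(10^j). Only
  derivatives enter the growth condition and the inequality, so the derivative is the basic object
  and the function is recovered later as a primitive.\<close>

definition lacunary :: "(nat \<Rightarrow> real) \<Rightarrow> complex \<Rightarrow> complex" where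
  "lacunary c z = (\<Sum>j. of_real (c j * 10 ^ j) * z ^ (10 ^ j - 1))"

lemma norm_lacunary_term:
  "norm (of_real (c * 10 ^ j) * z ^ n :: complex) = \<bar>c\<bar> * 10 ^ j * norm z ^ n"
  by (simp add: norm_mult norm_power abs_mult)

lemma summable_norm_lacunary:
  assumes "\<And>j. \<bar>c j\<bar> \<le> M" "norm z < 1"
  shows "summable (\<lambda>j. norm (of_real (c j * 10 ^ j) * z ^ (10 ^ j - 1) :: complex))"
proof (rule summable_comparison_test')
  show "summable (\<lambda>j. M * (10 ^ j * norm z ^ (10 ^ j - 1)))"
    using assms by (intro summable_mult summable_lacunary) auto
  show "norm (norm (of_real (c j * 10 ^ j) * z ^ (10 ^ j - 1)))
          \<le> M * (10 ^ j * norm z ^ (10 ^ j - 1))" for j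
    using mult_right_mono[OF assms(1), of "10 ^ j * norm z ^ (10 ^ j - 1)"]
    by (simp add: norm_lacunary_term mult.assoc norm_mult norm_power abs_mult)
qed

lemma holomorphic_lacunary:
  assumes "\<And>j. \<bar>c j\<bar> \<le> M"
  shows "lacunary c holomorphic_on ball 0 1"
proof (rule holomorphic_uniform_sequence)
  show "(\<lambda>z. \<Sum>j<n. of_real (c j * 10 ^ j) * z ^ (10 ^ j - 1)) holomorphic_on ball 0 1" for n
    by (intro holomorphic_intros)
  fix z :: complex assume z: "z \<in> ball 0 1"
  \<comment> \<open>Half the distance to the unit circle: on the closed disc of radius
    \<open>d\<close> about \<open>z\<close> the moduli stay below \<open>norm z + d < 1\<close>, and
    the model series at that radius serves as majorant in the M-test.\<close>
  define d where "d = (1 - norm z) / 2"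
  have d: "d > 0" "norm z + d < 1"
    using z by (auto simp: d_def field_simps)
  have sub: "norm w \<le> norm z + d" if "w \<in> cball z d" for w
    using that norm_triangle_sub[of w z] by (simp add: dist_norm norm_minus_commute)
  have "uniform_limit (cball z d) (\<lambda>n w. \<Sum>j<n. of_real (c j * 10 ^ j) * w ^ (10 ^ j - 1))
          (\<lambda>w. \<Sum>j. of_real (c j * 10 ^ j) * w ^ (10 ^ j - 1)) sequentially"
  proof (rule Weierstrass_m_test)
    show "summable (\<lambda>j. M * (10 ^ j * (norm z + d) ^ (10 ^ j - 1)))"
      using d by (intro summable_mult summable_lacunary) auto
    show "norm (of_real (c j * 10 ^ j) * w ^ (10 ^ j - 1)) \<le> M * (10 ^ j * (norm z + d) ^ (10 ^ j - 1))"
      if "w \<in> cball z d" for j w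
      unfolding norm_lacunary_term mult.assoc
      using assms[of j] sub[OF that] by (intro mult_mono power_mono) auto
  qed
  then have "uniform_limit (cball z d) (\<lambda>n w. \<Sum>j<n. of_real (c j * 10 ^ j) * w ^ (10 ^ j - 1))
          (lacunary c) sequentially"
    by (simp add: lacunary_def[abs_def])
  moreover have "cball z d \<subseteq> ball 0 1"
    using sub d by fastforce
  ultimately show "\<exists>d>0. cball z d \<subseteq> ball 0 1 \<and>
      uniform_limit (cball z d) (\<lambda>n w. \<Sum>j<n. of_real (c j * 10 ^ j) * w ^ (10 ^ j - 1))
          (lacunary c) sequentially"
    using d by blast
qed simp

text \<open>The head costs a constant independent of \<open>z\<close>, and the tail at most
  \<open>e\<close> times the model series. Letting \<open>e\<close> shrink therefore yields growth
  o(1 / (1 - |z|)).\<close>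

lemma norm_lacunary_le:
  assumes c: "\<And>j. \<bar>c j\<bar> \<le> M" and tail: "\<And>j. j \<ge> N \<Longrightarrow> \<bar>c j\<bar> \<le> e" and z: "norm z < 1"
  shows "norm (lacunary c z) \<le> (\<Sum>j<N. \<bar>c j\<bar> * 10 ^ j) + e * (10 / 9 / (1 - norm z))"
proof -
  have e: "0 \<le> e"
    using tail[of N] by simp
  \<comment> \<open>The head majorant is added to the full \<open>e\<close>-series rather than to
    its tail; the overlap on indices below \<open>N\<close> only weakens the bound.\<close>
  define h where "h j = (if j < N then \<bar>c j\<bar> * 10 ^ j else 0)" for j
  have h: "h sums (\<Sum>j<N. \<bar>c j\<bar> * 10 ^ j)"
    using sums_If_finite[of "\<lambda>j. j < N" "\<lambda>j. \<bar>c j\<bar> * 10 ^ j"]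
    by (simp add: h_def[abs_def] lessThan_def)
  have g: "(\<lambda>j. e * (10 ^ j * norm z ^ (10 ^ j - 1))) sums (e * (\<Sum>j. 10 ^ j * norm z ^ (10 ^ j - 1)))"
    using z by (intro sums_mult summable_sums summable_lacunary) auto
  note s = sums_add[OF h g]
  have "norm (of_real (c j * 10 ^ j) * z ^ (10 ^ j - 1)) \<le> h j + e * (10 ^ j * norm z ^ (10 ^ j - 1))" for j
  proof (cases "j < N")
    case True
    have "\<bar>c j\<bar> * 10 ^ j * norm z ^ (10 ^ j - 1) \<le> \<bar>c j\<bar> * 10 ^ j * 1"
      using z by (intro mult_left_mono power_le_one) auto
    then show ?thesis
      using True e unfolding h_def norm_lacunary_term by (simp add: add_increasing2)
  next
    case False
    then have "\<bar>c j\<bar> * (10 ^ j * norm z ^ (10 ^ j - 1)) \<le> e * (10 ^ j * norm z ^ (10 ^ j - 1))"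
      by (intro mult_right_mono tail) auto
    with False show ?thesis
      unfolding h_def norm_lacunary_term by (simp add: mult.assoc)
  qed
  then have "norm (lacunary c z) \<le> (\<Sum>j<N. \<bar>c j\<bar> * 10 ^ j) + e * (\<Sum>j. 10 ^ j * norm z ^ (10 ^ j - 1))"
    unfolding lacunary_def sums_unique[OF s] using sums_summable[OF s]
    by (intro norm_suminf_le) auto
  also have "\<dots> \<le> (\<Sum>j<N. \<bar>c j\<bar> * 10 ^ j) + e * (10 / 9 / (1 - norm z))"
    using suminf_lacunary_le[of "norm z"] z e by (intro add_left_mono mult_left_mono) auto
  finally show ?thesis .
qed

lemma tendsto_lacunary_boundary:
  assumes c: "c \<longlonglongrightarrow> 0"
  shows "((\<lambda>z. (1 - (norm z)\<^sup>2) * norm (lacunary c z)) \<longlongrightarrow> 0) (filtercomap norm (at_left 1))"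
proof (rule tendstoI)
  fix \<epsilon> :: real assume "\<epsilon> > 0"
  \<comment> \<open>As 1 - |z|^2 <= 2 (1 - |z|), the final bound is 2 (1 + 10/9) \<epsilon> / 8 =
    19/36 \<epsilon>.\<close>
  define e where "e = \<epsilon> / 8"
  have e: "e > 0"
    using \<open>\<epsilon> > 0\<close> by (simp add: e_def)
  obtain M where M: "\<And>j. \<bar>c j\<bar> \<le> M"
    using convergent_imp_Bseq[OF convergentI[OF c]] by (auto simp: Bseq_def)
  obtain N where "\<And>j. j \<ge> N \<Longrightarrow> \<bar>c j\<bar> < e"
    using LIMSEQ_D[OF c e] by auto
  then have N: "\<And>j. j \<ge> N \<Longrightarrow> \<bar>c j\<bar> \<le> e"
    by (simp add: less_imp_le)
  define A where "A = (\<Sum>j<N. \<bar>c j\<bar> * 10 ^ j)"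
  have A: "A \<ge> 0"
    by (auto simp: A_def intro!: sum_nonneg)
  have "((\<lambda>r. (1 - r) * A) \<longlongrightarrow> (1 - 1) * A) (at_left 1)"
    by (intro tendsto_intros)
  then have "eventually (\<lambda>r. (1 - r) * A < e) (at_left 1)"
    using e order_tendstoD(2) by fastforce
  moreover have "eventually (\<lambda>r::real. r \<in> {0<..<1}) (at_left 1)"
    by (rule eventually_at_leftI[of 0]) auto
  ultimately have "eventually (\<lambda>r. (1 - r) * A < e \<and> r \<in> {0<..<1}) (at_left 1)"
    by (rule eventually_conj)
  then have "eventually (\<lambda>z::complex. (1 - norm z) * A < e \<and> norm z \<in> {0<..<1})
               (filtercomap norm (at_left 1))"
    by (rule eventually_filtercomapI)
  then show "eventually (\<lambda>z. dist ((1 - (norm z)\<^sup>2) * norm (lacunary c z)) 0 < \<epsilon>)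
               (filtercomap norm (at_left 1))"
  proof eventually_elim
    case (elim z)
    then have z: "norm z < 1" "0 \<le> norm z"
      by auto
    have "(1 - norm z) * norm (lacunary c z) \<le> (1 - norm z) * (A + e * (10 / 9 / (1 - norm z)))"
      unfolding A_def using z norm_lacunary_le[OF M N] by (intro mult_left_mono) auto
    also have "\<dots> = (1 - norm z) * A + e * (10 / 9)"
      using z by (simp add: distrib_left) (simp add: field_simps)
    also have "\<dots> < \<epsilon> / 8 + \<epsilon> / 8 * (10 / 9)"
      using elim unfolding e_def by (intro add_strict_right_mono) auto
    finally have *: "(1 - norm z) * norm (lacunary c z) < \<epsilon> / 8 + \<epsilon> / 8 * (10 / 9)" .
    have "(1 - (norm z)\<^sup>2) * norm (lacunary c z) = (1 + norm z) * ((1 - norm z) * norm (lacunary c z))"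
      by (simp add: power2_eq_square algebra_simps)
    also have "\<dots> \<le> 2 * ((1 - norm z) * norm (lacunary c z))"
      using z by (intro mult_right_mono) auto
    also have "\<dots> < \<epsilon>"
      using * \<open>\<epsilon> > 0\<close> by simp
    finally show ?case
      using z by (simp add: abs_mult abs_square_le_1 power_le_one)
  qed
qed

text \<open>The disc is convex, so the holomorphic series has a primitive there. The boundary limit
  carries over to its derivative because the filter eventually stays inside the disc.\<close>

lemma little_bloch_primitive_lacunary:
  assumes c: "c \<longlonglongrightarrow> 0"
  obtains f where "f \<in> little_bloch" "\<And>z. z \<in> ball 0 1 \<Longrightarrow> deriv f z = lacunary c z"
proof -
  obtain M where M: "\<And>j. \<bar>c j\<bar> \<le> M"
    using convergent_imp_Bseq[OF convergentI[OF c]] by (auto simp: Bseq_def)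
  obtain f where f: "\<And>z. z \<in> ball 0 1 \<Longrightarrow> (f has_field_derivative lacunary c z) (at z within ball 0 1)"
    using holomorphic_convex_primitive'[OF convex_ball open_ball holomorphic_lacunary[of c M, OF M]] by metis
  have f': "(f has_field_derivative lacunary c z) (at z)" if "z \<in> ball 0 1" for z
    using f[OF that] unfolding at_within_open[OF that open_ball] .
  have d: "deriv f z = lacunary c z" if "z \<in> ball 0 1" for z
    using f'[OF that] by (rule DERIV_imp_deriv)
  have "f holomorphic_on ball 0 1"
    unfolding holomorphic_on_def field_differentiable_def using f by blast
  then have an: "f analytic_on ball 0 1"
    by (simp only: analytic_on_open[OF open_ball])
  have "eventually (\<lambda>r::real. r < 1) (at_left 1)"
    by (rule eventually_at_leftI[of 0]) auto
  then have ev: "eventually (\<lambda>z::complex. norm z < 1) (filtercomap norm (at_left 1))"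
    by (rule eventually_filtercomapI)
  have "((\<lambda>z. (1 - (norm z)\<^sup>2) * norm (deriv f z)) \<longlongrightarrow> 0) (filtercomap norm (at_left 1))"
  proof (rule Lim_transform_eventually[OF tendsto_lacunary_boundary[OF c]])
    show "\<forall>\<^sub>F z in filtercomap norm (at_left 1).
        (1 - (norm z)\<^sup>2) * norm (lacunary c z) = (1 - (norm z)\<^sup>2) * norm (deriv f z)"
      using ev by eventually_elim (simp add: d)
  qed
  with an have "f \<in> little_bloch"
    by (simp add: little_bloch_def)
  then show ?thesis
    using d by (rule that)
qed

section \<open>Dominance of one term on a decimal annulus\<close>

text \<open>With m = n - 1 > 0, (1 - 1/n)^m = 1 / (1 + 1/m)^m, and (1 + 1/m)^m <= e <= 3. This keeps
  the dominant term from being small.\<close>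

lemma one_minus_inverse_power_ge:
  fixes r :: real
  assumes "n \<ge> 1" "1 - 1 / real n \<le> r"
  shows "1 / 3 \<le> r ^ (n - 1)"
proof (cases "n = 1")
  case False
  define m where "m = n - 1"
  have m: "n = Suc m" "m > 0"
    using False assms by (auto simp: m_def)
  have "(1 + 1 / real m) ^ m \<le> exp (1 / real m) ^ m"
    by (intro power_mono exp_ge_add_one_self) auto
  also have "\<dots> = exp 1"
    using m by (simp flip: exp_of_nat_mult)
  also have "\<dots> \<le> 3"
    by (rule exp_le)
  finally have "1 / 3 \<le> 1 / (1 + 1 / real m) ^ m"
    using m by (intro divide_left_mono) (auto intro!: zero_less_power add_pos_pos)
  also have "\<dots> = (1 - 1 / real n) ^ m"
  proof -
    have "1 - 1 / real n = 1 / (1 + 1 / real m)"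
      using m by (simp add: field_simps)
    then show ?thesis
      by (simp only: power_one_over)
  qed
  also have "\<dots> \<le> r ^ m"
    using assms m by (intro power_mono) (auto simp: field_simps)
  finally show ?thesis
    by (simp add: m_def)
qed simp

text \<open>Quantifies how the decay of later terms beats their factor 10^k with 5^k to spare. It
  fails for k = 1, which is why neighbouring indices go into different series.\<close>

lemma power_50_le_exp: "50 ^ k \<le> 3 * exp ((10 ^ k - 1) / 10 :: real)" if "k \<ge> 2" for k :: nat
  using that
proof (induction k rule: dec_induct)
  case base
  \<comment> \<open>The linear bound 1 + x <= exp x is too weak at x = 9.9, so it is applied at 0.99
    and raised to the tenth power.\<close>
  have "(199 / 100) ^ 10 \<le> exp (99 / 100 :: real) ^ 10"
    using exp_ge_add_one_self[of "99 / 100"] by (intro power_mono) auto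
  also have "\<dots> = exp (99 / 10)"
    by (simp flip: exp_of_nat_mult)
  finally have "(199 / 100 :: real) ^ 10 \<le> exp (99 / 10)" .
  moreover have "(2500 :: real) \<le> 3 * (199 / 100) ^ 10"
    by (simp add: power_divide)
  ultimately have "2500 \<le> 3 * exp (99 / 10 :: real)"
    by linarith
  then show ?case
    by simp
next
  case (step k)
  \<comment> \<open>Passing to k + 1 adds 9 * 10^k / 10 >= 90 to the exponent, hence a factor of at
    least 91 on the right against 50 on the left.\<close>
  have "(10::real) ^ 2 \<le> 10 ^ k"
    using step by (intro power_increasing) auto
  then have "50 \<le> 1 + 9 * 10 ^ k / (10 :: real)"
    by simp
  also have "\<dots> \<le> exp (9 * 10 ^ k / 10)"
    by (rule exp_ge_add_one_self)
  finally have "50 ^ k * 50 \<le> (3 * exp ((10 ^ k - 1) / 10)) * exp (9 * 10 ^ k / 10 :: real)"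
    using step by (intro mult_mono) auto
  also have "\<dots> = 3 * exp ((10 ^ k - 1) / 10 + 9 * 10 ^ k / 10)"
    by (simp add: exp_add)
  also have "(10 ^ k - 1) / 10 + 9 * 10 ^ k / 10 = (10 ^ Suc k - 1) / (10 :: real)"
    by (simp add: field_simps)
  finally show ?case
    by (simp add: mult.commute)
qed

text \<open>The quotient of the two terms is 10^k r^p with p = 10^(J+k) - 10^J. From r <= exp(-1 /
  10^(J+1)) the power r^p is at most exp(-(10^k - 1) / 10), hence at most 3 / 50^k.\<close>

lemma lacunary_later_term_le:
  fixes r :: real
  assumes r: "0 \<le> r" "r \<le> 1 - 1 / 10 ^ Suc J" and k: "k \<ge> 2"
  shows "10 ^ (J + k) * r ^ (10 ^ (J + k) - 1) \<le> 3 / 5 ^ k * (10 ^ J * r ^ (10 ^ J - 1))"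
proof -
  define p :: nat where "p = 10 ^ (J + k) - 10 ^ J"
  have le: "(10 ^ J :: nat) \<le> 10 ^ (J + k)"
    by (intro power_increasing) auto
  have split: "10 ^ (J + k) - 1 = (10 ^ J - 1) + p"
    using le by (simp add: p_def)
  have "r ^ p \<le> exp (- (1 / 10 ^ Suc J)) ^ p"
    using r exp_ge_add_one_self[of "- (1 / 10 ^ Suc J)"] by (intro power_mono) linarith+
  also have "\<dots> = exp (- (real p / 10 ^ Suc J))"
    by (simp flip: exp_of_nat_mult)
  also have "real p / 10 ^ Suc J = (10 ^ k - 1) / 10"
    using le by (simp add: p_def of_nat_diff field_simps power_add)
  finally have "r ^ p \<le> 1 / exp ((10 ^ k - 1) / 10)"
    by (simp add: exp_minus inverse_eq_divide)
  also have "\<dots> \<le> 1 / (50 ^ k / 3)"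
    using power_50_le_exp[OF k] by (intro divide_left_mono) auto
  finally have "10 ^ k * r ^ p \<le> 10 ^ k * (3 / 50 ^ k)"
    by (intro mult_left_mono) auto
  also have "\<dots> = 3 / 5 ^ k"
  proof -
    have "(50::real) ^ k = 10 ^ k * 5 ^ k"
      by (simp flip: power_mult_distrib)
    then show ?thesis
      by simp
  qed
  finally have "(10 ^ k * r ^ p) * (10 ^ J * r ^ (10 ^ J - 1)) \<le> 3 / 5 ^ k * (10 ^ J * r ^ (10 ^ J - 1))"
    using r by (intro mult_right_mono) auto
  moreover have "r ^ (10 ^ (J + k) - 1) = r ^ (10 ^ J - 1) * r ^ p"
    unfolding split by (rule power_add)
  ultimately show ?thesis
    by (simp only: power_add[of "10::real" J k] mult_ac)
qed

text \<open>Budget relative to the term of index \<open>J\<close>: the earlier terms take at most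
  3/4, the next one vanishes, the rest take at most 3/20, so 1/10 survives. That term itself is at
  least \<open>c J * 10 ^ J / 3\<close>.\<close>

lemma norm_lacunary_ge:
  assumes c: "\<And>j. 0 \<le> c j"
    and gap: "c (Suc J) = 0"
    and earlier: "\<And>i. i \<le> J \<Longrightarrow> c i \<le> 2 ^ (J - i) * c J"
    and later: "\<And>i. i \<ge> J \<Longrightarrow> c i \<le> c J"
    and z: "1 - 1 / 10 ^ J \<le> norm z" "norm z \<le> 1 - 1 / 10 ^ Suc J"
  shows "c J * 10 ^ J / 30 \<le> norm (lacunary c z)"
proof -
  define t where "t i = (of_real (c i * 10 ^ i) * z ^ (10 ^ i - 1) :: complex)" for i
  have nt: "norm (t i) = c i * 10 ^ i * norm z ^ (10 ^ i - 1)" for i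
    unfolding t_def norm_lacunary_term using c by simp
  have third: "1 / 3 \<le> norm z ^ (10 ^ J - 1)"
    by (rule one_minus_inverse_power_ge) (use z in auto)
  have "0 < 1 / (10::real) ^ Suc J"
    by simp
  then have z1: "norm z < 1"
    using z(2) by linarith
  have bdd: "\<bar>c j\<bar> \<le> Max (c ` {..J})" for j
  proof (cases "j \<le> J")
    case False
    then have "c j \<le> c J"
      by (intro later) auto
    also have "\<dots> \<le> Max (c ` {..J})"
      by (intro Max_ge) auto
    finally show ?thesis
      using c by simp
  qed (use c in \<open>auto intro!: Max_ge\<close>)
  have sn: "summable (\<lambda>i. norm (t i))"
    unfolding t_def using summable_norm_lacunary[OF bdd z1] .
  \<comment> \<open>Going back one index costs at most a factor 2 in the coefficient but gains 10
    from the power of ten, a net ratio of 1/5. The 3 pays for the factor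
    \<open>norm z ^ (10 ^ J - 1)\<close> in \<open>norm (t J)\<close>.\<close>
  have "norm (t i) \<le> 3 / 5 ^ (J - i) * norm (t J)" if "i \<le> J" for i
  proof -
    have "norm (t i) \<le> c i * 10 ^ i"
      unfolding nt using c z1 by (intro mult_left_le) (auto intro: power_le_one)
    also have "\<dots> \<le> 2 ^ (J - i) * c J * 10 ^ i"
      using earlier[OF that] by (intro mult_right_mono) auto
    also have "\<dots> = c J * 10 ^ J / 5 ^ (J - i)"
    proof -
      have "(10::real) ^ (J - i) = 2 ^ (J - i) * 5 ^ (J - i)"
        by (simp flip: power_mult_distrib)
      moreover have "(10::real) ^ J = 10 ^ i * 10 ^ (J - i)"
        using that by (simp flip: power_add)
      ultimately show ?thesis
        by simp
    qed
    also have "\<dots> \<le> c J * 10 ^ J / 5 ^ (J - i) * (3 * norm z ^ (10 ^ J - 1))"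
      using third mult_left_mono[of 1 "3 * norm z ^ (10 ^ J - 1)" "c J * 10 ^ J / 5 ^ (J - i)"] c by simp
    finally show ?thesis
      unfolding nt by (simp add: mult_ac)
  qed
  then have "norm (\<Sum>i<J. t i) \<le> (\<Sum>i<J. 3 / 5 ^ (J - i) * norm (t J))"
    by (intro sum_norm_le) auto
  also have "\<dots> = (\<Sum>k<J. 3 / 5 ^ Suc k) * norm (t J)"
    by (subst sum.nat_diff_reindex[symmetric]) (simp add: sum_distrib_right Suc_diff_Suc)
  also have "(\<Sum>k<J. 3 / 5 ^ Suc k :: real) = 3 / 4 * (1 - 1 / 5 ^ J)"
  proof (induction J)
    case (Suc J)
    show ?case
      unfolding sum.lessThan_Suc Suc.IH by (simp add: field_simps)
  qed simp
  also have "\<dots> * norm (t J) \<le> 3 / 4 * norm (t J)"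
    by (intro mult_right_mono) auto
  finally have early: "norm (\<Sum>i<J. t i) \<le> 3 / 4 * norm (t J)" .

  \<comment> \<open>The tail starts at J + 2, hence 3/25 = 3 / 5^2; the geometric sum is 3/25 * 5/4
    = 3/20.\<close>
  have "norm (t (k + (J + 2))) \<le> 3 / 25 * norm (t J) * (1 / 5) ^ k" for k
  proof -
    have "norm (t (k + (J + 2))) \<le> c J * (10 ^ (J + (k + 2)) * norm z ^ (10 ^ (J + (k + 2)) - 1))"
      unfolding nt mult.assoc add.left_commute[of k J 2] using later[of "J + (k + 2)"]
      by (intro mult_right_mono) auto
    also have "\<dots> \<le> c J * (3 / 5 ^ (k + 2) * (10 ^ J * norm z ^ (10 ^ J - 1)))"
      using z c by (intro mult_left_mono lacunary_later_term_le) auto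
    finally show ?thesis
      unfolding nt by (simp add: power_add power_one_over field_simps)
  qed
  moreover have "(\<lambda>k. 3 / 25 * norm (t J) * (1 / 5) ^ k) sums (3 / 25 * norm (t J) * (1 / (1 - 1 / 5)))"
    by (intro sums_mult geometric_sums) auto
  ultimately have "norm (\<Sum>k. t (k + (J + 2))) \<le> 3 / 25 * norm (t J) * (1 / (1 - 1 / 5))"
    by (metis norm_suminf_le sums_summable sums_unique)
  then have late: "norm (\<Sum>k. t (k + (J + 2))) \<le> 3 / 20 * norm (t J)"
    by simp

  have "lacunary c z = (\<Sum>k. t (k + (J + 2))) + (\<Sum>i<J + 2. t i)"
    unfolding lacunary_def using suminf_split_initial_segment[OF summable_norm_cancel[OF sn], of "J + 2"]
    by (simp only: t_def)
  also have "(\<Sum>i<J + 2. t i) = (\<Sum>i<J. t i) + t J"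
    using gap by (simp add: t_def)
  finally have "norm (t J) = norm (lacunary c z - (\<Sum>k. t (k + (J + 2))) - (\<Sum>i<J. t i))"
    by simp
  also have "\<dots> \<le> norm (lacunary c z) + norm (\<Sum>k. t (k + (J + 2))) + norm (\<Sum>i<J. t i)"
    by (meson norm_triangle_ineq4 order_trans add_right_mono)
  finally have "norm (t J) / 10 \<le> norm (lacunary c z)"
    using early late by simp
  moreover have "c J * 10 ^ J * (1 / 3) \<le> norm (t J)"
    unfolding nt using third c by (intro mult_left_mono) auto
  ultimately show ?thesis
    by simp
qed

section \<open>Choice of coefficients and covering of the disc by annuli\<close>

text \<open>Follow \<open>w\<close>, but never drop by more than half in one step. The resulting
  sequence decreases to some L, and passing to the limit in its recursion gives L = max 0 (L / 2),
  so L = 0.\<close>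

lemma slowly_decreasing_majorant:
  fixes w :: "nat \<Rightarrow> real"
  assumes nonneg: "\<And>j. 0 \<le> w j" and dec: "decseq w" and lim: "w \<longlonglongrightarrow> 0"
  obtains b where "\<And>j. w j \<le> b j" "decseq b" "b \<longlonglongrightarrow> 0" "\<And>j. b j \<le> 2 * b (Suc j)"
proof
  define b where "b = rec_nat (w 0) (\<lambda>j x. max (w (Suc j)) (x / 2))"
  have b_simps: "b 0 = w 0" "b (Suc j) = max (w (Suc j)) (b j / 2)" for j
    by (simp_all add: b_def)
  show ge: "w j \<le> b j" for j
    by (cases j) (simp_all add: b_simps)
  have nn: "0 \<le> b j" for j
    using ge[of j] nonneg[of j] by simp
  show b_dec: "decseq b"
  proof (rule decseq_SucI)
    fix j
    show "b (Suc j) \<le> b j"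
      using ge[of j] nn[of j] decseqD[OF dec, of j "Suc j"] by (simp add: b_simps)
  qed
  show "b j \<le> 2 * b (Suc j)" for j
    by (simp add: b_simps)
  obtain L where L: "b \<longlonglongrightarrow> L"
    using decseq_convergent[OF b_dec] nn by blast
  have "(\<lambda>j. b (Suc j)) \<longlonglongrightarrow> max 0 (L / 2)"
    unfolding b_simps by (intro tendsto_intros LIMSEQ_Suc[OF lim] L) simp
  then have "L = max 0 (L / 2)"
    using LIMSEQ_Suc[OF L] LIMSEQ_unique by blast
  then have "L = 0"
    by (simp add: max_def split: if_splits)
  with L show "b \<longlonglongrightarrow> 0"
    by simp
qed

lemma ex_decimal_annulus:
  fixes r :: real
  assumes "0 \<le> r" "r < 1"
  obtains J where "1 - 1 / 10 ^ J \<le> r" "r \<le> 1 - 1 / 10 ^ Suc J"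
proof -
  have "\<exists>n. (1 / 10) ^ n < 1 - r"
    using assms by (intro real_arch_pow_inv) auto
  then have ex: "\<exists>n. (1 / 10) ^ n \<le> 1 - r"
    using less_imp_le by blast
  define n where "n = (LEAST n. (1 / 10) ^ n \<le> 1 - r)"
  have n: "(1 / 10) ^ n \<le> 1 - r"
    unfolding n_def using ex by (rule LeastI_ex)
  show ?thesis
  proof (cases n)
    \<comment> \<open>No predecessor of \<open>n\<close> exists here; this forces r = 0, which the
      innermost annulus J = 0 contains.\<close>
    case 0
    with n assms have "r = 0"
      by simp
    with that[of 0] show ?thesis
      by simp
  next
    case (Suc J)
    then have "\<not> (1 / 10) ^ J \<le> 1 - r"
      using not_less_Least[of J "\<lambda>n. (1 / 10) ^ n \<le> 1 - r"] by (simp add: n_def)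
    with n Suc that[of J] show ?thesis
      by (simp add: power_one_over)
  qed
qed

section \<open>Splitting the coefficients by parity of the index\<close>

theorem theorem2p1:
  fixes W :: "real \<Rightarrow> real"
  assumes "W \<in> {0..<1} \<rightarrow> {0<..<1}"
    and "continuous_on {0..<1} W"
    and "antimono_on {0..<1} W"
    and "(W \<longlongrightarrow> 0) (at_left 1)"
  shows "\<exists>f\<in>little_bloch. \<exists>g\<in>little_bloch. \<forall>z\<in>ball 0 1.
           norm (deriv f z) + norm (deriv g z) \<ge> W (norm z) / (1 - norm z)"
proof -
  have anti: "W y \<le> W x" if "0 \<le> x" "x \<le> y" "y < 1" for x y
    using assms(3) that by (auto simp: monotone_on_def)
  \<comment> \<open>Sampled at the inner radius of annulus \<open>j\<close>, where monotonicity
    makes the value a bound for \<open>W\<close> on the whole annulus.\<close>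
  define w where "w j = W (1 - 1 / 10 ^ j)" for j :: nat
  have pos: "0 \<le> w j" for j
    using assms(1) by (force simp: w_def Pi_iff less_imp_le)
  have dec: "decseq w"
    unfolding w_def by (intro decseq_SucI anti) (auto simp: field_simps)
  have "filterlim (\<lambda>j::nat. 1 - (1 / 10) ^ j :: real) (at_left 1) sequentially"
  proof (rule tendsto_imp_filterlim_at_left)
    have "(\<lambda>j::nat. 1 - (1 / 10) ^ j :: real) \<longlonglongrightarrow> 1 - 0"
      by (intro tendsto_intros LIMSEQ_power_zero) auto
    then show "(\<lambda>j::nat. 1 - (1 / 10) ^ j :: real) \<longlonglongrightarrow> 1"
      by simp
  qed auto
  then have lim: "w \<longlonglongrightarrow> 0"
    using filterlim_compose[OF assms(4)] by (simp add: w_def[abs_def] power_one_over)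
  obtain b where b: "\<And>j. w j \<le> b j" "decseq b" "b \<longlonglongrightarrow> 0" "\<And>j. b j \<le> 2 * b (Suc j)"
    using slowly_decreasing_majorant[OF pos dec lim] by blast
  have nn: "0 \<le> b j" for j
    using pos[of j] b(1)[of j] by simp
  have slow: "b i \<le> 2 ^ (J - i) * b J" if "i \<le> J" for i J
    using that
  proof (induction J rule: dec_induct)
    case (step J)
    have "2 ^ (J - i) * b J \<le> 2 ^ (J - i) * (2 * b (Suc J))"
      by (intro mult_left_mono b) auto
    with step.IH have "b i \<le> 2 ^ (J - i) * (2 * b (Suc J))"
      by (rule order_trans)
    with step.hyps show ?case
      by (simp add: Suc_diff_le mult_ac)
  qed simp
  \<comment> \<open>\<open>c 0\<close> keeps the even indices and \<open>c 1\<close> the odd ones,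
    giving the required zero after each kept index. The constant is 30 * 10: 30 from the lower bound
    for the series, 10 from 1 / (1 - |z|) <= 10^(J+1).\<close>
  define c where "c s j = (if even (s + j) then 300 * b j else 0)" for s j :: nat
  have "c s \<longlonglongrightarrow> 0" for s
  proof (rule Lim_null_comparison)
    show "\<forall>\<^sub>F j in sequentially. norm (c s j) \<le> 300 * b j"
      using nn by (simp add: c_def)
    show "(\<lambda>j. 300 * b j) \<longlonglongrightarrow> 0"
      using tendsto_mult_right_zero[OF b(3)] by simp
  qed
  then have "\<exists>f\<in>little_bloch. \<forall>z\<in>ball 0 1. deriv f z = lacunary (c s) z" for s
    by (rule little_bloch_primitive_lacunary[of "c s"]) blast+
  from this[of 0] this[of 1] obtain f g where fg: "f \<in> little_bloch" "g \<in> little_bloch"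
    "\<And>z. z \<in> ball 0 1 \<Longrightarrow> deriv f z = lacunary (c 0) z"
    "\<And>z. z \<in> ball 0 1 \<Longrightarrow> deriv g z = lacunary (c 1) z"
    by metis
  have "W (norm z) / (1 - norm z) \<le> norm (deriv f z) + norm (deriv g z)" if "z \<in> ball 0 1" for z
  proof -
    have z: "norm z < 1"
      using that by simp
    obtain J where J: "1 - 1 / 10 ^ J \<le> norm z" "norm z \<le> 1 - 1 / 10 ^ Suc J"
      using ex_decimal_annulus[OF norm_ge_zero z] .
    have "W (norm z) \<le> w J"
      unfolding w_def by (intro anti J z) auto
    also have "\<dots> \<le> b J"
      by (rule b)
    finally have "W (norm z) / (1 - norm z) \<le> b J / (1 / 10 ^ Suc J)"
      using J nn by (intro frac_le) auto
    \<comment> \<open>\<open>J mod 2\<close> selects the series that keeps index \<open>J\<close>;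
      the norm of the other one is merely nonnegative.\<close>
    also have "\<dots> = c (J mod 2) J * 10 ^ J / 30"
      by (simp add: c_def)
    also have "\<dots> \<le> norm (lacunary (c (J mod 2)) z)"
    proof (rule norm_lacunary_ge[OF _ _ _ _ J])
      show "c (J mod 2) i \<le> 2 ^ (J - i) * c (J mod 2) J" if "i \<le> J" for i
        using slow[OF that] nn[of J] by (auto simp: c_def)
      show "c (J mod 2) i \<le> c (J mod 2) J" if "J \<le> i" for i
        using decseqD[OF b(2) that] nn[of J] by (auto simp: c_def)
    qed (use nn in \<open>auto simp: c_def\<close>)
    also have "\<dots> \<le> norm (lacunary (c 0) z) + norm (lacunary (c 1) z)"
      by (cases "even J") (auto simp: even_iff_mod_2_eq_zero odd_iff_mod_2_eq_one)
    finally show ?thesis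
      using fg that by simp
  qed
  with fg show ?thesis
    by blast
qed

end
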